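(* Let $b=ck$ with $c,k$ positive integers, where $b$ is odd, $c$ is not a perfect square, and $(c,k)=1$. Let $f_b(x)$ be the inversion polynomial of $b$. Then every primitive $2k$-th root of unity $\zeta_{2k}$ is a root of $f_b(x)$. If moreover $b$ is not divisible by three, then every primitive $6k$-th root of unity $\zeta_{6k}$ is also a root of $f_b(x)$.
   Context: For a permutation $\sigma$ of $\{1,2,\dots,b\}$, its inversion number is $\operatorname{inv}(\sigma)=\#\{(i,j) : 1\le i<j\le b,\ \sigma(i)>\sigma(j)\}$. If $a$ is an integer relatively prime to $b$, let $\sigma_a:\{1,\dots,b\}\to\{1,\dots,b\}$ be the permutation sending $x$ to the unique element of $\{1,\dots,b\}$ congruent to $ax$ modulo $b$, and put $\operatorname{inv}(a,b)=\operatorname{inv}(\sigma_a)$. The inversion polynomial of a positive integer $b$ is $f_b(x)=\sum_{1\le a\le b,\ (a,b)=1} x^{\operatorname{inv}(a,b)}$. *)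

theory Defs
  imports
    "HOL-Computational_Algebra.Computational_Algebra"
    "HOL-Number_Theory.Cong"
    "HOL-Combinatorics.Permutations"
begin

definition inversion_number :: "nat \<Rightarrow> (nat \<Rightarrow> nat) \<Rightarrow> nat" where
  "inversion_number b \<sigma> = card {(i, j). 1 \<le> i \<and> i < j \<and> j \<le> b \<and> \<sigma> i > \<sigma> j}"

(* restrict_id: the identity outside {1..b}, as "permutes {1..b}" requires. *)
definition mult_perm :: "int \<Rightarrow> nat \<Rightarrow> nat \<Rightarrow> nat" where
  "mult_perm a b =
     restrict_id (\<lambda>x. THE y. y \<in> {1..b} \<and> [int y = a * int x] (mod int b)) {1..b}"

definition mult_inv :: "int \<Rightarrow> nat \<Rightarrow> nat" where
  "mult_inv a b = inversion_number b (mult_perm a b)"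

definition inversion_poly :: "nat \<Rightarrow> int poly" where
  "inversion_poly b = (\<Sum>a | 1 \<le> a \<and> a \<le> b \<and> coprime a b. monom 1 (mult_inv (int a) b))"

definition primitive_root_of_unity :: "nat \<Rightarrow> complex \<Rightarrow> bool" where
  "primitive_root_of_unity n z \<longleftrightarrow> n > 0 \<and> z ^ n = 1 \<and> (\<forall>m. 0 < m \<and> m < n \<longrightarrow> z ^ m \<noteq> 1)"

lemma ex1_residue_1_to_n:
  fixes m :: int
  assumes "b > 0"
  shows "\<exists>!y. y \<in> {1..b} \<and> [int y = m] (mod int b)"
proof (rule ex_ex1I)
  define y where "y = nat ((m - 1) mod int b + 1)"
  have nn: "0 \<le> (m - 1) mod int b" "(m - 1) mod int b < int b"
    using assms by simp_all
  have "[(m - 1) mod int b + 1 = (m - 1) + 1] (mod int b)"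
    by (intro cong_add) (simp_all add: cong_def)
  then have "[int y = m] (mod int b)"
    using nn by (simp add: y_def)
  moreover have "y \<in> {1..b}"
    using nn by (auto simp: y_def)
  ultimately show "\<exists>y. y \<in> {1..b} \<and> [int y = m] (mod int b)" by blast
next
  fix y z
  assume y: "y \<in> {1..b} \<and> [int y = m] (mod int b)"
    and z: "z \<in> {1..b} \<and> [int z = m] (mod int b)"
  then have "[int y = int z] (mod int b)"
    by (meson cong_sym cong_trans)
  then have "int b dvd int y - int z"
    by (simp add: cong_iff_dvd_diff)
  moreover have "\<bar>int y - int z\<bar> < int b"
    using y z by auto
  ultimately show "y = z"
    using zdvd_imp_le[of "int b" "\<bar>int y - int z\<bar>"] by force
qed

lemma mult_perm_props:
  assumes "b > 0" "x \<in> {1..b}"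
  shows "mult_perm a b x \<in> {1..b}" "[int (mult_perm a b x) = a * int x] (mod int b)"
  using theI'[OF ex1_residue_1_to_n[OF assms(1), of "a * int x"]] assms(2)
  by (simp_all add: mult_perm_def restrict_id_def)

lemma mult_perm_permutes:
  assumes "b > 0" "coprime a (int b)"
  shows "mult_perm a b permutes {1..b}"
proof (rule bij_imp_permutes)
  have "inj_on (mult_perm a b) {1..b}"
  proof (rule inj_onI)
    fix x y
    assume x: "x \<in> {1..b}" and y: "y \<in> {1..b}" and eq: "mult_perm a b x = mult_perm a b y"
    have "[a * int x = a * int y] (mod int b)"
      using mult_perm_props(2)[OF assms(1) x, of a] mult_perm_props(2)[OF assms(1) y, of a] eq
      by (metis cong_sym cong_trans)
    then have "[int x = int y] (mod int b)"
      using assms(2) by (simp add: cong_mult_lcancel)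
    then show "x = y"
      using ex1_residue_1_to_n[OF assms(1), of "int y"] x y by auto
  qed
  moreover have "mult_perm a b ` {1..b} \<subseteq> {1..b}"
    using mult_perm_props(1)[OF assms(1)] by blast
  ultimately show "bij_betw (mult_perm a b) {1..b} {1..b}"
    by (simp add: bij_betw_def endo_inj_surj)
next
  show "mult_perm a b x = x" if "x \<notin> {1..b}" for x
    using that by (auto simp: mult_perm_def restrict_id_def)
qed

end

theory Submission
  imports Defs "HOL-Number_Theory.Residue_Primitive_Roots"
begin

text \<open>
  Let \<open>\<zeta>\<close> be a primitive root of unity of order \<open>2 * h\<close>, where \<open>h\<close> is \<open>k\<close> or \<open>3 * k\<close>. Then
  \<open>\<zeta> ^ h = - 1\<close>, and the value of the inversion polynomial at \<open>\<zeta>\<close> is the sum of \<open>\<zeta> ^ inv(a, b)\<close> over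
  the reduced residues \<open>a\<close> modulo \<open>b\<close>. It suffices to find one unit \<open>u\<close> modulo \<open>b\<close> such that
  \<open>inv(u a, b)\<close> and \<open>inv(a, b)\<close> always differ by an odd multiple of \<open>h\<close>: replacing \<open>a\<close> by \<open>u a\<close> then
  permutes the terms of the sum and negates each of them. Since \<open>h\<close> is odd, this splits into
  conditions modulo \<open>k\<close>, modulo \<open>3\<close> and modulo \<open>2\<close>.

  Modulo \<open>k\<close> and \<open>3\<close>. An inversion \<open>i < j\<close> is a carry in the addition of the residues of \<open>a i\<close> and
  \<open>a (j - i)\<close> modulo \<open>b\<close> (\<open>residue_inversion_indicator\<close>). Summing over all pairs expresses
  \<open>b inv(a, b)\<close> through the sum of \<open>i\<close> times the residue of \<open>a i\<close>, the quantity behind the Dedekind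
  sum. This gives \<open>3 dvd inv(a, b)\<close> if \<open>3\<close> does not divide \<open>b\<close> (\<open>three_dvd_mult_inv\<close>), and
  \<open>4 a inv(a, b) = - (a - 1)\<^sup>2\<close> modulo \<open>b\<close> (\<open>mult_inv_cong\<close>). So for \<open>u = 1\<close> modulo \<open>k\<close> the
  inversion number does not change modulo \<open>k\<close>, nor modulo \<open>3\<close> if \<open>3\<close> does not divide \<open>b\<close>.

  Modulo \<open>2\<close>. The sign \<open>(- 1) ^ inv(a, b)\<close> is the Jacobi symbol of \<open>a\<close> by Zolotarev's theorem, and a
  \<open>u\<close> that is \<open>1\<close> modulo \<open>k\<close> and has sign \<open>- 1\<close> exists because the Jacobi symbol modulo the nonsquare
  \<open>c\<close> is a nontrivial character. This is proved directly: the pairs \<open>i < j\<close> are sorted into layers by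
  the additive order \<open>n\<close> of \<open>j - i\<close> modulo \<open>b\<close>, and the sign on a layer is congruent modulo \<open>n\<close> to a
  power of \<open>a\<close> (\<open>difference_layer_sign\<close>) whose exponent is \<open>b * totient n / 2\<close>
  (\<open>card_difference_layer\<close>). For a suitable \<open>u\<close> exactly the layers of order \<open>p, ..., p ^ e\<close>, where
  the prime \<open>p\<close> has odd multiplicity \<open>e\<close> in \<open>c\<close>, contribute \<open>- 1\<close> (\<open>ex_sign_flipping_multiplier\<close>).
\<close>

section \<open>Inversions in terms of residues\<close>

text \<open>
  Only the residues modulo \<open>b\<close> matter, and the index \<open>b\<close>, a fixed point of the permutation, may be
  replaced by the index \<open>0\<close>: neither takes part in an inversion. Least nonnegative residues
  \<open>a * i mod b\<close> with \<open>0 \<le> i < b\<close> satisfy simpler identities than representatives in \<open>{1..b}\<close>.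
\<close>

definition residue_inversions :: "nat \<Rightarrow> nat \<Rightarrow> (nat \<times> nat) set" where
  "residue_inversions a b = {(i, j). i < j \<and> j < b \<and> a * j mod b < a * i mod b}"

text \<open>
  Writing the condition as \<open>b = n * gcd (j - i) b\<close> says that \<open>j - i\<close> has additive order \<open>n\<close>
  modulo \<open>b\<close>. Multiplication by a unit preserves this order, so it permutes the pairs of a layer.
\<close>

definition difference_layer :: "nat \<Rightarrow> nat \<Rightarrow> (nat \<times> nat) set" where
  "difference_layer b n = {(i, j). i < j \<and> j < b \<and> b = n * gcd (j - i) b}"

lemma finite_pairs_below: "finite {(i, j). i < j \<and> j < (b :: nat)}"
  by (rule finite_subset[of _ "{..<b} \<times> {..<b}"]) auto

lemma finite_residue_inversions: "finite (residue_inversions a b)"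
  unfolding residue_inversions_def by (rule finite_subset[OF _ finite_pairs_below[of b]]) auto

lemma finite_difference_layer: "finite (difference_layer b n)"
  unfolding difference_layer_def by (rule finite_subset[OF _ finite_pairs_below[of b]]) auto

lemma coprime_mult_mod_eq_0_iff:
  fixes a b x :: nat
  assumes "coprime a b"
  shows "a * x mod b = 0 \<longleftrightarrow> b dvd x"
  using assms by (metis coprime_commute coprime_dvd_mult_right_iff mod_eq_0_iff_dvd)

lemma mult_perm_eq_mod:
  assumes "coprime a b" "0 < x" "x < b"
  shows "mult_perm (int a) b x = a * x mod b"
proof -
  have b: "b > 0" using assms by simp
  have "[int (a * x mod b) = int a * int x] (mod int b)"
    by (simp add: cong_def zmod_int)
  moreover have "a * x mod b \<in> {1..b}"
    using coprime_mult_mod_eq_0_iff[OF assms(1), of x] assms b nat_dvd_not_less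
    by (simp add: Suc_le_eq)
  ultimately show ?thesis
    using ex1_residue_1_to_n[OF b, of "int a * int x"] mult_perm_props[OF b, of x "int a"] assms
    by auto
qed

lemma mult_perm_top:
  assumes "b > 0"
  shows "mult_perm a b b = b"
proof -
  have "[int b = a * int b] (mod int b)" by (simp add: cong_def)
  then show ?thesis
    using ex1_residue_1_to_n[OF assms, of "a * int b"] mult_perm_props[OF assms, of b a] assms
    by auto
qed

lemma mult_inv_eq_card:
  assumes "b > 0" "coprime a b"
  shows "mult_inv (int a) b = card (residue_inversions a b)"
proof -
  have "(1 \<le> i \<and> i < j \<and> j \<le> b \<and> mult_perm (int a) b j < mult_perm (int a) b i) \<longleftrightarrow>
        (i < j \<and> j < b \<and> a * j mod b < a * i mod b)" for i j
  proof (cases "1 \<le> i \<and> i < j \<and> j < b")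
    case True
    then show ?thesis using mult_perm_eq_mod[OF assms(2)] by simp
  next
    case False
    have "\<not> mult_perm (int a) b b < mult_perm (int a) b i" if "1 \<le> i" "i < b"
      using mult_perm_props(1)[OF assms(1), of i "int a"] that mult_perm_top[OF assms(1)] by simp
    with False show ?thesis by (cases "j = b"; cases "i = 0") auto
  qed
  then show ?thesis
    unfolding mult_inv_def inversion_number_def residue_inversions_def by simp
qed

section \<open>The inversion number modulo b and modulo three\<close>

text \<open>
  Each value \<open>r i\<close> is counted \<open>n - 1 - i\<close> times as \<open>r i\<close>, \<open>n - i\<close> times as \<open>r (j - i)\<close> (the
  differences run over positive numbers, but \<open>r 0 = 0\<close>), and \<open>i\<close> times with a minus sign.
\<close>

lemma sum_pairs_below:
  fixes r :: "nat \<Rightarrow> int"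
  assumes "r 0 = 0"
  shows "(\<Sum>j<n. \<Sum>i<j. r i + r (j - i) - r j) = (\<Sum>i<n. r i * (2 * int n - 1 - 3 * int i))"
proof (induction n)
  case (Suc n)
  have "(\<Sum>i<n. r (n - i)) = (\<Sum>i<Suc n. r (n - i))" using assms by simp
  also have "\<dots> = (\<Sum>i<Suc n. r i)"
    using sum.nat_diff_reindex[of r "Suc n"] by simp
  finally have *: "(\<Sum>i<n. r (n - i)) = (\<Sum>i<n. r i) + r n" by simp
  have "(\<Sum>i<Suc n. r i * (2 * int (Suc n) - 1 - 3 * int i))
      = (\<Sum>i<n. r i * (2 * int n - 1 - 3 * int i)) + 2 * (\<Sum>i<n. r i) + r n * (1 - int n)"
    by (simp add: sum_distrib_left sum.distrib[symmetric] algebra_simps)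
  with Suc * show ?case
    by (simp add: sum.distrib sum_subtractf algebra_simps)
qed simp

text \<open>
  The residue of \<open>a * j\<close> is the sum of the residues of \<open>a * i\<close> and \<open>a * (j - i)\<close>, reduced by \<open>b\<close> if
  there is a carry; a carry makes it smaller than the residue of \<open>a * i\<close>, and no carry makes it
  larger. Hence inversions are exactly the carries, which turns their number into a linear sum.
\<close>

lemma residue_inversion_indicator:
  fixes a b i j :: nat
  assumes "coprime a b" "i < j" "j < b"
  shows "int (a * i mod b) + int (a * (j - i) mod b) - int (a * j mod b)
       = (if a * j mod b < a * i mod b then int b else 0)"
proof -
  define x y where "x = a * i mod b" and "y = a * (j - i) mod b"
  have "\<not> b dvd j - i" using assms by (simp add: nat_dvd_not_less)
  then have y: "y > 0" using coprime_mult_mod_eq_0_iff[OF assms(1), of "j - i"] by (simp add: y_def)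
  have xy: "x < b" "y < b" using assms by (auto simp: x_def y_def)
  have "a * j mod b = (x + y) mod b"
    using assms unfolding x_def y_def
    by (metis add_diff_inverse_nat distrib_left mod_add_eq not_less_iff_gr_or_eq)
  also have "\<dots> = (if x + y < b then x + y else x + y - b)"
    using xy by (simp add: mod_if)
  finally show ?thesis using y xy unfolding x_def[symmetric] y_def[symmetric] by auto
qed

lemma card_residue_inversions:
  assumes "b > 0" "coprime a b"
  shows "int b * int (card (residue_inversions a b))
       = (\<Sum>i<b. int (a * i mod b) * (2 * int b - 1 - 3 * int i))"
proof -
  have eq: "residue_inversions a b = (SIGMA j:{..<b}. {i. i < j \<and> a * j mod b < a * i mod b})\<inverse>"
    by (auto simp: residue_inversions_def)
  have "int b * int (card (residue_inversions a b))
      = (\<Sum>j<b. int b * int (card {i. i < j \<and> a * j mod b < a * i mod b}))"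
    unfolding eq by (simp add: card_inverse sum_distrib_left)
  also have "\<dots> = (\<Sum>j<b. \<Sum>i<j. if a * j mod b < a * i mod b then int b else 0)"
    by (intro sum.cong refl) (simp add: sum.If_cases Int_def mult.commute)
  also have "\<dots> = (\<Sum>j<b. \<Sum>i<j. int (a * i mod b) + int (a * (j - i) mod b) - int (a * j mod b))"
    using residue_inversion_indicator[OF assms(2)] by (intro sum.cong refl) simp
  also have "\<dots> = (\<Sum>i<b. int (a * i mod b) * (2 * int b - 1 - 3 * int i))"
    by (rule sum_pairs_below) simp
  finally show ?thesis .
qed

lemma bij_betw_mult_mod:
  fixes a b :: nat
  assumes "b > 0" "coprime a b"
  shows "bij_betw (\<lambda>i. a * i mod b) {..<b} {..<b}"
proof -
  have "inj_on (\<lambda>i. a * i mod b) {..<b}"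
    using assms by (intro inj_onI) (metis cong_def cong_less_modulus_unique_nat cong_mult_lcancel_nat lessThan_iff)
  then show ?thesis
    using assms(1) by (intro bij_betw_imageI endo_inj_surj) auto
qed

lemma sum_residues:
  fixes f :: "nat \<Rightarrow> int"
  assumes "b > 0" "coprime a b"
  shows "(\<Sum>i<b. f (a * i mod b)) = (\<Sum>i<b. f i)"
  using sum.reindex_bij_betw[OF bij_betw_mult_mod[OF assms]] .

lemma two_sum_below: "2 * (\<Sum>i<n. int i) = int n * (int n - 1)"
  by (induction n) (auto simp: algebra_simps)

lemma six_sum_squares_below: "6 * (\<Sum>i<n. (int i)\<^sup>2) = int n * (int n - 1) * (2 * int n - 1)"
  by (induction n) (auto simp: algebra_simps power2_eq_square)

lemma twice_card_residue_inversions: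
  assumes "b > 0" "coprime a b"
  shows "2 * int b * int (card (residue_inversions a b))
       = int b * (int b - 1) * (2 * int b - 1) - 6 * (\<Sum>i<b. int i * int (a * i mod b))"
proof -
  define S where "S = (\<Sum>i<b. int i * int (a * i mod b))"
  have "int b * int (card (residue_inversions a b))
      = (2 * int b - 1) * (\<Sum>i<b. int (a * i mod b)) - 3 * S"
    unfolding card_residue_inversions[OF assms] S_def
    by (simp add: sum_distrib_left sum_subtractf[symmetric] algebra_simps)
  also have "(\<Sum>i<b. int (a * i mod b)) = (\<Sum>i<b. int i)"
    by (rule sum_residues[OF assms])
  finally have "2 * (int b * int (card (residue_inversions a b)))
      = (2 * int b - 1) * (2 * (\<Sum>i<b. int i)) - 6 * S" by (simp add: algebra_simps)
  then show ?thesis unfolding two_sum_below S_def by (simp add: algebra_simps)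
qed

text \<open>
  The term containing the residues has the factor \<open>6\<close>, and one of \<open>b\<close>, \<open>b - 1\<close>, \<open>2 * b - 1\<close> is
  divisible by three; dividing by \<open>2 * b\<close> is possible modulo three.
\<close>

lemma three_dvd_mult_inv:
  assumes "b > 0" "coprime a b" "\<not> 3 dvd b"
  shows "3 dvd mult_inv (int a) b"
proof -
  define N where "N = int (card (residue_inversions a b))"
  have p3: "prime (3::int)" by simp
  have b3: "\<not> 3 dvd int b" using assms(3) by presburger
  then have "3 dvd (int b - 1) * (2 * int b - 1)"
    unfolding prime_dvd_mult_iff[OF p3] by presburger
  then have "3 dvd int b * (int b - 1) * (2 * int b - 1)" by (simp add: mult.assoc)
  then have "3 dvd 2 * int b * N"
    unfolding N_def twice_card_residue_inversions[OF assms(1,2)] by (intro dvd_diff) auto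
  then have "3 dvd N" using b3 by (auto simp: prime_dvd_mult_iff[OF p3])
  then show ?thesis using mult_inv_eq_card[OF assms(1,2)] unfolding N_def by presburger
qed

text \<open>
  By the previous formula, twice the inversion number modulo \<open>b\<close> is determined by the sum \<open>S\<close> of the
  products of \<open>i\<close> and its image, modulo \<open>b\<^sup>2\<close>. The images have the same sum of squares \<open>T\<close> as the
  indices, and \<open>a * i\<close> differs from its residue by a multiple of \<open>b\<close>; expanding the squares of these
  differences gives \<open>2 * a * S = (a\<^sup>2 + 1) * T\<close> modulo \<open>b\<^sup>2\<close>, with \<open>T\<close> known explicitly. This is the
  reciprocity-type congruence for Dedekind sums in disguise.
\<close>

lemma mult_inv_cong:
  assumes "b > 0" "coprime a b"
  shows "[4 * int a * int (mult_inv (int a) b) = - (int a - 1)\<^sup>2] (mod int b)"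
proof -
  define N where "N = int (card (residue_inversions a b))"
  define S where "S = (\<Sum>i<b. int i * int (a * i mod b))"
  define T where "T = (\<Sum>i<b. (int i)\<^sup>2)"
  define B A where "B = int b" and "A = int a"
  define Q where "Q = (\<Sum>i<b. (int (a * i div b))\<^sup>2)"
  have r: "A * int i - int (a * i mod b) = B * int (a * i div b)" for i
    unfolding A_def B_def by (metis add_diff_cancel_right' mult_div_mod_eq of_nat_add of_nat_mult)
  have "(\<Sum>i<b. (A * int i - int (a * i mod b))\<^sup>2) = B\<^sup>2 * Q"
    unfolding r Q_def by (simp add: power_mult_distrib sum_distrib_left)
  moreover have "(\<Sum>i<b. (A * int i - int (a * i mod b))\<^sup>2)
      = A\<^sup>2 * T - 2 * A * S + (\<Sum>i<b. (int (a * i mod b))\<^sup>2)"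
    unfolding T_def S_def
    by (simp add: power2_diff power_mult_distrib sum.distrib sum_subtractf sum_distrib_left algebra_simps)
  moreover have "(\<Sum>i<b. (int (a * i mod b))\<^sup>2) = T"
    unfolding T_def using sum_residues[OF assms, of "\<lambda>i. (int i)\<^sup>2"] by simp
  ultimately have S: "2 * A * S = (A\<^sup>2 + 1) * T - B\<^sup>2 * Q" by (simp add: algebra_simps)
  have N: "2 * B * N = B * (B - 1) * (2 * B - 1) - 6 * S"
    unfolding B_def N_def S_def by (rule twice_card_residue_inversions[OF assms])
  have T: "6 * T = B * (B - 1) * (2 * B - 1)"
    unfolding B_def T_def by (rule six_sum_squares_below)
  have "B * (4 * A * N) = 2 * A * (2 * B * N)" by (simp add: algebra_simps)
  also have "\<dots> = 2 * A * (B * (B - 1) * (2 * B - 1)) - 6 * (2 * A * S)"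
    unfolding N by (simp add: algebra_simps)
  also have "\<dots> = 2 * A * (B * (B - 1) * (2 * B - 1)) - (A\<^sup>2 + 1) * (6 * T) + 6 * B\<^sup>2 * Q"
    unfolding S by (simp add: algebra_simps)
  also have "\<dots> = B * (- (A - 1)\<^sup>2 + B * ((3 - 2 * B) * (A - 1)\<^sup>2 + 6 * Q))"
    unfolding T by (simp add: algebra_simps power2_eq_square)
  finally have "4 * A * N = - (A - 1)\<^sup>2 + B * ((3 - 2 * B) * (A - 1)\<^sup>2 + 6 * Q)"
    using assms(1) by (simp add: B_def)
  then show ?thesis
    unfolding mult_inv_eq_card[OF assms] N_def A_def B_def by (simp add: cong_iff_dvd_diff)
qed

section \<open>The parity of the inversions within a layer\<close>

lemma layer_index_dvd: "(i, j) \<in> difference_layer b n \<Longrightarrow> n dvd b"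
  unfolding difference_layer_def by (auto intro: dvdI)

text \<open>
  This is Zolotarev's argument on one layer. Let \<open>d = b / n\<close>. Each difference \<open>j - i\<close> in the layer is
  \<open>d\<close> times a number prime to \<open>n\<close>, and so is the difference of the images, which is congruent to
  \<open>a * (j - i)\<close> modulo \<open>b\<close>. Up to order, the image pairs are the pairs of the layer again. So the
  product of all quotients by \<open>d\<close> changes by the sign of the inversions on the one hand, and by a
  factor \<open>a\<close> for each pair modulo \<open>n\<close> on the other; the product itself is prime to \<open>n\<close> and cancels.
\<close>

lemma difference_layer_sign:
  assumes "b > 0" "coprime a b"
  shows "[(- 1) ^ card (residue_inversions a b \<inter> difference_layer b n)
        = int a ^ card (difference_layer b n)] (mod int n)"
proof (cases "n dvd b")
  case False
  then have "difference_layer b n = {}" using layer_index_dvd[of _ _ b n] by auto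
  then show ?thesis by simp
next
  case True
  define d where "d = b div n"
  define L where "L = difference_layer b n"
  define w :: "nat \<times> nat \<Rightarrow> int" where "w = (\<lambda>(i, j). (int j - int i) div int d)"
  define r where "r = (\<lambda>i. a * i mod b)"
  \<comment> \<open>\<open>\<phi>\<close> maps a pair to its image pair, sorted; \<open>s\<close> records whether sorting was necessary.\<close>
  define \<phi> where "\<phi> = (\<lambda>(i, j). (min (r i) (r j), max (r i) (r j)))"
  define s :: "nat \<times> nat \<Rightarrow> int" where
    "s = (\<lambda>(i, j). if r j < r i then - 1 else 1)"
  have bd: "b = n * d" using True by (simp add: d_def)
  have pos: "n > 0" "d > 0" using bd assms(1) by auto
  have fin: "finite L" unfolding L_def by (rule finite_difference_layer)
  have inL: "(i, j) \<in> L \<longleftrightarrow> i < j \<and> j < b \<and> gcd (int j - int i) (int b) = int d" for i j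
  proof (cases "i < j")
    case True
    have "b = n * g \<longleftrightarrow> g = d" for g using pos bd by auto
    moreover have "int j - int i = int (j - i)" using True by simp
    ultimately show ?thesis
      unfolding L_def difference_layer_def mem_Collect_eq case_prod_conv
      by (simp only: gcd_int_int_eq of_nat_eq_iff)
  qed (simp add: L_def difference_layer_def)
  have r_inj: "r i = r j \<Longrightarrow> i < b \<Longrightarrow> j < b \<Longrightarrow> i = j" for i j
    using inj_onD[OF bij_betw_imp_inj_on[OF bij_betw_mult_mod[OF assms]], of i j] by (simp add: r_def)
  have r_lt: "r i < b" for i using assms(1) by (simp add: r_def)
  have r_cong: "[int (r i) = int a * int i] (mod int b)" for i
    unfolding r_def by (simp add: cong_def zmod_int)
  have diff_cong: "[int (r j) - int (r i) = int a * (int j - int i)] (mod int b)" for i j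
    using cong_diff[OF r_cong[of j] r_cong[of i]] by (simp add: right_diff_distrib)
  have gcd_r: "gcd (int (r j) - int (r i)) (int b) = gcd (int j - int i) (int b)" for i j
  proof -
    have "gcd (int (r j) - int (r i)) (int b) = gcd (int a * (int j - int i)) (int b)"
      using cong_gcd_eq[OF diff_cong] by (simp add: gcd.commute)
    then show ?thesis using assms(2)
      by (simp add: gcd_mult_left_left_cancel coprime_commute)
  qed
  have \<phi>_in: "\<phi> x \<in> L" if "x \<in> L" for x
  proof -
    from that obtain i j where x: "x = (i, j)" "i < j" "j < b" "gcd (int j - int i) (int b) = int d"
      by (cases x) (auto simp: inL)
    have ne: "r i \<noteq> r j" using r_inj x by (metis less_trans nat_neq_iff)
    have "gcd (int (r i) - int (r j)) (int b) = int d"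
      using gcd_r[of j i] x(4) by (metis gcd_neg1_int minus_diff_eq)
    then show ?thesis
      using ne x gcd_r[of j i] r_lt by (auto simp: \<phi>_def inL min_def max_def)
  qed
  have "inj_on \<phi> L"
  proof (rule inj_onI)
    fix x y assume "x \<in> L" "y \<in> L" and eq: "\<phi> x = \<phi> y"
    then obtain i j k l where xy: "x = (i, j)" "i < j" "j < b" "y = (k, l)" "k < l" "l < b"
      by (cases x; cases y) (auto simp: inL)
    have "(r i = r k \<and> r j = r l) \<or> (r i = r l \<and> r j = r k)"
      using eq xy by (auto simp: \<phi>_def min_def max_def split: if_splits)
    then show "x = y" using xy r_inj by (metis less_trans not_less_iff_gr_or_eq)
  qed
  then have bij: "bij_betw \<phi> L L"
    using \<phi>_in fin by (intro bij_betw_imageI endo_inj_surj) auto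
  have w_mult: "int j - int i = int d * w (i, j)" if "(i, j) \<in> L" for i j
    using that unfolding inL w_def by (metis case_prod_conv dvd_mult_div_cancel gcd_dvd1)
  have w_coprime: "coprime (w x) (int n)" if "x \<in> L" for x
  proof (cases x)
    case (Pair i j)
    have ij: "(i, j) \<in> L" using that Pair by simp
    have "gcd (int j - int i) (int b) = int d" using ij unfolding inL by simp
    moreover have "int b = int d * int n" unfolding bd by simp
    ultimately have "gcd (int d * w x) (int d * int n) = int d"
      using w_mult[OF ij] Pair by simp
    then have "int d * gcd (w x) (int n) = int d" by (simp add: gcd_mult_left)
    then show ?thesis using pos by (simp add: coprime_iff_gcd_eq_1)
  qed
  have step: "[s x * w (\<phi> x) = int a * w x] (mod int n)" if "x \<in> L" for x
  proof (cases x)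
    case (Pair i j)
    have ij: "(i, j) \<in> L" using that Pair by simp
    have "\<phi> x \<in> L" by (rule \<phi>_in[OF that])
    then have "int (max (r i) (r j)) - int (min (r i) (r j)) = int d * w (\<phi> x)"
      using w_mult unfolding Pair \<phi>_def by simp
    then have "int (r j) - int (r i) = s x * (int d * w (\<phi> x))"
      unfolding Pair s_def by (simp add: min_def max_def split: if_splits)
    then have "[int d * (s x * w (\<phi> x)) = int a * (int d * w x)] (mod int b)"
      using diff_cong[of j i] w_mult[OF ij] unfolding Pair by (simp add: mult.left_commute)
    then have "int d * int n dvd int d * (s x * w (\<phi> x) - int a * w x)"
      unfolding cong_iff_dvd_diff bd by (simp add: algebra_simps)
    then show ?thesis using pos by (simp add: cong_iff_dvd_diff)
  qed
  have "(\<Prod>x\<in>L. s x) = (- 1) ^ card (residue_inversions a b \<inter> L)"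
  proof -
    have "residue_inversions a b \<inter> L = L \<inter> {x. r (snd x) < r (fst x)}"
      by (auto simp: residue_inversions_def inL r_def)
    moreover have "(\<Prod>x\<in>L. s x) = (\<Prod>x\<in>L. if r (snd x) < r (fst x) then - 1 else 1)"
      by (intro prod.cong) (auto simp: s_def)
    ultimately show ?thesis using fin by (simp add: prod.If_cases Int_def)
  qed
  moreover have "(\<Prod>x\<in>L. w (\<phi> x)) = (\<Prod>x\<in>L. w x)"
    by (rule prod.reindex_bij_betw[OF bij])
  moreover have "[(\<Prod>x\<in>L. s x * w (\<phi> x)) = (\<Prod>x\<in>L. int a * w x)] (mod int n)"
    by (intro cong_prod step)
  ultimately have "[(- 1) ^ card (residue_inversions a b \<inter> L) * (\<Prod>x\<in>L. w x)
      = int a ^ card L * (\<Prod>x\<in>L. w x)] (mod int n)"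
    by (simp add: prod.distrib)
  moreover have "coprime (\<Prod>x\<in>L. w x) (int n)"
    using w_coprime by (intro prod_coprime_left) auto
  ultimately show ?thesis unfolding L_def[symmetric] by (simp add: cong_mult_rcancel)
qed

text \<open>
  A difference \<open>t\<close> occurs for \<open>b - t\<close> pairs. The differences \<open>t\<close> and \<open>b - t\<close> belong to the same
  layer, so on average each of the \<open>totient n\<close> differences occurs for \<open>b / 2\<close> pairs.
\<close>

lemma card_difference_layer:
  assumes "b > 0" "n dvd b" "n > 1"
  shows "2 * card (difference_layer b n) = b * totient n"
proof -
  define d where "d = b div n"
  have bd: "b = n * d" using assms by (simp add: d_def)
  have pos: "d > 0" using bd assms(1) by auto
  define D where "D = {t \<in> {0<..b}. gcd t b = d}"
  have D: "card D = totient n"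
    unfolding D_def using card_gcd_eq_totient[of b d] assms pos bd by auto
  have b_notin: "b \<notin> D" using bd assms pos by (auto simp: D_def)
  have D_lt: "t \<in> D \<Longrightarrow> t < b" for t using b_notin by (auto simp: D_def le_less)
  have fin: "finite D" by (simp add: D_def)
  have layer: "(i, j) \<in> difference_layer b n \<longleftrightarrow> i < j \<and> j < b \<and> j - i \<in> D" for i j
  proof -
    have "b = n * g \<longleftrightarrow> g = d" for g using pos bd assms by auto
    then show ?thesis
      unfolding difference_layer_def D_def mem_Collect_eq case_prod_conv by auto
  qed
  have "bij_betw (\<lambda>(t, i). (i, i + t)) (SIGMA t:D. {..<b - t}) (difference_layer b n)"
    by (rule bij_betwI[where g = "\<lambda>(i, j). (j - i, i)"]) (auto simp: layer, auto simp: D_def)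
  then have "card (difference_layer b n) = card (SIGMA t:D. {..<b - t})"
    by (simp add: bij_betw_same_card)
  also have "\<dots> = (\<Sum>t\<in>D. b - t)" using fin by simp
  finally have card1: "card (difference_layer b n) = (\<Sum>t\<in>D. b - t)" .
  have gcd_minus: "gcd (b - t) b = gcd t b" if "t \<le> b" for t
    using that by (metis gcd_diff1_nat gcd.commute gcd_diff2_nat)
  have "(\<Sum>t\<in>D. b - t) = (\<Sum>t\<in>D. t)"
    by (rule sum.reindex_bij_witness[where i = "\<lambda>t. b - t" and j = "\<lambda>t. b - t"])
       (use D_lt gcd_minus in \<open>auto simp: D_def\<close>)
  then have "2 * card (difference_layer b n) = (\<Sum>t\<in>D. (b - t) + t)"
    using card1 by (simp add: sum.distrib)
  also have "\<dots> = (\<Sum>t\<in>D. b)" using D_lt by (intro sum.cong) (auto simp: less_imp_le)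
  finally show ?thesis using D by (simp add: mult.commute)
qed

lemma sign_mult_inv_eq_prod:
  assumes "b > 0" "coprime a b"
  shows "(- 1 :: int) ^ mult_inv (int a) b
       = (\<Prod>n | n dvd b \<and> n > 1. (- 1) ^ card (residue_inversions a b \<inter> difference_layer b n))"
proof -
  let ?N = "{n. n dvd b \<and> n > 1}"
  have fin: "finite ?N" using assms(1) by auto
  have "residue_inversions a b = (\<Union>n\<in>?N. residue_inversions a b \<inter> difference_layer b n)"
  proof (intro equalityI subsetI)
    fix x assume x: "x \<in> residue_inversions a b"
    obtain i j where ij: "x = (i, j)" "i < j" "j < b"
      using x by (auto simp: residue_inversions_def)
    define n where "n = b div gcd (j - i) b"
    have bn: "b = n * gcd (j - i) b" by (simp add: n_def)
    have "gcd (j - i) b \<le> j - i" using ij by (intro dvd_imp_le) auto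
    then have "gcd (j - i) b \<noteq> b" using ij by linarith
    then have "n \<noteq> 1" using bn by (metis mult_1)
    moreover have "n \<noteq> 0" using bn assms(1) by (metis mult_0 less_numeral_extra(3))
    moreover have "n dvd b" using bn by (metis dvd_triv_left)
    ultimately have "n \<in> ?N" by simp
    then show "x \<in> (\<Union>n\<in>?N. residue_inversions a b \<inter> difference_layer b n)"
      using x ij bn by (auto simp: difference_layer_def)
  qed auto
  then have "card (residue_inversions a b) = card (\<Union>n\<in>?N. residue_inversions a b \<inter> difference_layer b n)"
    by simp
  also have "\<dots> = (\<Sum>n\<in>?N. card (residue_inversions a b \<inter> difference_layer b n))"
  proof (intro card_UN_disjoint fin ballI impI)
    fix n m assume "n \<in> ?N" "m \<in> ?N" "n \<noteq> m"
    have "n = m" if "b = n * gcd t b" "b = m * gcd t b" for t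
      using that assms(1) by (metis mult_cancel2 gr0_conv_Suc mult_is_0 nat.distinct(1))
    then show "(residue_inversions a b \<inter> difference_layer b n)
        \<inter> (residue_inversions a b \<inter> difference_layer b m) = {}"
      using \<open>n \<noteq> m\<close> by (auto simp: difference_layer_def)
  qed (simp add: finite_residue_inversions)
  finally show ?thesis using mult_inv_eq_card[OF assms] by (simp add: power_sum)
qed

lemma sign_eq_of_cong:
  fixes x y :: int
  assumes "[(- 1) ^ i = (- 1 :: int) ^ j] (mod int n)" "n > 2"
  shows "(- 1 :: int) ^ i = (- 1) ^ j"
proof (rule ccontr)
  assume "(- 1 :: int) ^ i \<noteq> (- 1) ^ j"
  then have "int n dvd 2"
    using assms(1) by (cases "even i"; cases "even j") (auto simp: cong_iff_dvd_diff)
  then show False using assms(2) zdvd_imp_le[of "int n" 2] by simp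
qed

text \<open>
  The power of a primitive root is a square root of \<open>1\<close>, but not \<open>1\<close> itself because of the order.
\<close>

lemma ex_half_power_eq_minus_one:
  fixes p :: nat
  assumes "prime p" "odd p"
  obtains g where "coprime g p" "[int g ^ ((p - 1) div 2) = - 1] (mod int p)"
proof -
  obtain g where g: "residue_primroot p g"
    using prime_primitive_root_exists[OF prime_gt_1_nat[OF assms(1)] assms(1)] by auto
  have p2: "p > 2" using assms prime_ge_2_nat[of p] by (cases "p = 2") auto
  have cop: "coprime p g" and ord: "ord p g = p - 1"
    using g assms by (auto simp: residue_primroot_def totient_prime)
  define h where "h = (p - 1) div 2"
  have h: "2 * h = p - 1" "0 < h" "h < p - 1" using assms p2 by (auto simp: h_def)
  have "\<not> [g ^ h = 1] (mod p)" using ord_minimal[of h p g] h ord by auto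
  then have "\<not> [int g ^ h = 1] (mod int p)"
    by (metis cong_int_iff of_nat_1 of_nat_power)
  moreover have "[g ^ (2 * h) = 1] (mod p)" using ord[symmetric] ord_works[of g p] h by metis
  then have "[int g ^ (2 * h) = 1] (mod int p)"
    by (metis cong_int_iff of_nat_1 of_nat_power)
  then have "int p dvd (int g ^ h - 1) * (int g ^ h + 1)"
    by (simp add: cong_iff_dvd_diff power_mult power2_eq_square algebra_simps mult_2 power_add)
  ultimately have "int p dvd int g ^ h + 1"
    using assms by (auto simp: prime_dvd_mult_iff cong_iff_dvd_diff)
  then have "[int g ^ h = - 1] (mod int p)" by (simp add: cong_iff_dvd_diff)
  then show ?thesis using that cop unfolding h_def by (simp add: coprime_commute)
qed

section \<open>A multiplier that changes every parity\<close>

text \<open>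
  The sign on a layer is given by a power of the multiplier and hence multiplicative in it. Signs are
  already determined modulo any divisor \<open>g > 1\<close> of \<open>n\<close>, since \<open>g\<close> is odd and thus exceeds \<open>2\<close>; so the
  sign contributed by \<open>u\<close> may be computed modulo such a \<open>g\<close>.
\<close>

lemma layer_sign_mult:
  assumes "b > 0" "coprime u b" "coprime a b" "odd b"
    and "n dvd b" "g dvd n" "g > 1"
    and cong: "[int u ^ card (difference_layer b n) = (- 1) ^ e] (mod int g)"
  shows "(- 1 :: int) ^ card (residue_inversions (u * a) b \<inter> difference_layer b n)
       = (- 1) ^ e * (- 1) ^ card (residue_inversions a b \<inter> difference_layer b n)"
proof -
  let ?N = "card (difference_layer b n)"
  have "odd g" using assms by (meson dvd_trans)
  then have g: "g > 2" using \<open>g > 1\<close> by (cases "g = 2") auto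
  have mod_g: "[x = y] (mod int n) \<Longrightarrow> [x = y] (mod int g)" for x y
    using cong_dvd_modulus[of x y "int n" "int g"] assms by simp
  have "[(- 1) ^ card (residue_inversions (u * a) b \<inter> difference_layer b n)
      = int u ^ ?N * int a ^ ?N] (mod int g)"
    using mod_g[OF difference_layer_sign[of b "u * a" n]] assms by (simp add: power_mult_distrib)
  also have "[int u ^ ?N * int a ^ ?N = (- 1) ^ e
      * (- 1) ^ card (residue_inversions a b \<inter> difference_layer b n)] (mod int g)"
    by (intro cong_mult cong cong_sym[OF mod_g[OF difference_layer_sign]] assms)
  finally show ?thesis
    using sign_eq_of_cong[OF _ g] unfolding power_add[symmetric] by blast
qed

text \<open>
  As \<open>c\<close> is not a square, some prime \<open>p\<close> divides it with an odd multiplicity \<open>e\<close>; write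
  \<open>b = p ^ e * m\<close>, where \<open>k\<close> divides \<open>m\<close>. Choose \<open>u\<close> to be a quadratic nonresidue modulo \<open>p\<close> and \<open>1\<close>
  modulo \<open>m\<close>. On a layer whose index shares a factor with \<open>m\<close>, the sign of \<open>u\<close> is trivial modulo that
  factor. The remaining layers have the indices \<open>p ^ j\<close> with \<open>1 \<le> j \<le> e\<close>; each has an odd multiple of
  \<open>(p - 1) / 2\<close> pairs, so that \<open>u\<close> contributes \<open>- 1\<close>. Altogether this gives the sign \<open>(- 1) ^ e = - 1\<close>.
\<close>

lemma ex_sign_flipping_multiplier:
  assumes "b = c * k" "odd b" "\<not> is_square c" "coprime c k"
  obtains u where "coprime u b" "[u = 1] (mod k)"
    "\<And>a. coprime a b \<Longrightarrow> (- 1 :: int) ^ mult_inv (int (u * a)) b = - ((- 1) ^ mult_inv (int a) b)"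
proof -
  obtain p where p: "prime p" "odd (multiplicity p c)"
    using assms(3) is_nth_power_conv_multiplicity_nat[of 2 c] by auto
  define e where "e = multiplicity p c"
  have b0: "b > 0" using assms(2) by (cases b) auto
  obtain c' where c': "c = p ^ e * c'" "\<not> p dvd c'"
  proof -
    have "c \<noteq> 0" "\<not> is_unit p" using b0 assms(1) p(1) not_prime_unit by auto
    then show ?thesis using multiplicity_decompose'[of c p] that unfolding e_def by metis
  qed
  define m where "m = c' * k"
  have b: "b = p ^ e * m" using assms(1) c' by (simp add: m_def)
  have "e > 0" using p by (auto simp: e_def intro: Nat.gr0I)
  then have "p dvd c" using c' by simp
  then have "\<not> p dvd k" using assms(4) p(1) by (metis coprime_common_divisor not_prime_unit)
  then have "\<not> p dvd m" using c' p by (simp add: m_def prime_dvd_mult_iff)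
  then have "coprime p m" using p(1) by (simp add: prime_imp_coprime)
  have odd_p: "odd p" using assms(2) \<open>e > 0\<close> b by auto
  obtain g where g: "coprime g p" "[int g ^ ((p - 1) div 2) = - 1] (mod int p)"
    using ex_half_power_eq_minus_one[OF p(1) odd_p] .
  obtain u where u: "[u = g] (mod p)" "[u = 1] (mod m)"
    using binary_chinese_remainder_nat[OF \<open>coprime p m\<close>] by metis
  have "coprime u p" using u(1) g(1) by (metis cong_imp_coprime cong_sym)
  moreover have "coprime u m" using u(2) by (metis cong_imp_coprime cong_sym coprime_1_left)
  ultimately have cop_u: "coprime u b" unfolding b by simp
  have u_p: "[int u ^ ((p - 1) div 2) = - 1] (mod int p)"
    using cong_pow[of "int u" "int g" "int p" "(p - 1) div 2"] u(1) g(2)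
    by (metis cong_int_iff cong_trans)
  define P where "P = (\<lambda>j. p ^ j) ` {1..e}"
  have card_P: "card P = e"
    unfolding P_def using prime_gt_1_nat[OF p(1)] by (simp add: card_image inj_on_def)
  let ?N = "{n. n dvd b \<and> n > 1}"
  have flip: "(- 1 :: int) ^ card (residue_inversions (u * a) b \<inter> difference_layer b n)
      = (if n \<in> P then - 1 else 1) * (- 1) ^ card (residue_inversions a b \<inter> difference_layer b n)"
    if n: "n \<in> ?N" and a: "coprime a b" for n a
  proof (cases "n \<in> P")
    case True
    then obtain j where j: "n = p ^ j" "1 \<le> j" by (auto simp: P_def)
    have "2 * card (difference_layer b n) = 2 * ((p - 1) div 2 * (b * p ^ (j - 1)))"
      using card_difference_layer[OF b0, of n] n totient_prime_power[of p j] j p(1) odd_p by simp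
    then have card: "card (difference_layer b n) = (p - 1) div 2 * (b * p ^ (j - 1))" by simp
    have "[int u ^ card (difference_layer b n) = (- 1) ^ (b * p ^ (j - 1))] (mod int p)"
      unfolding card power_mult by (intro cong_pow u_p)
    then have "[int u ^ card (difference_layer b n) = (- 1) ^ 1] (mod int p)"
      using odd_p assms(2) by simp
    then have "(- 1 :: int) ^ card (residue_inversions (u * a) b \<inter> difference_layer b n)
        = (- 1) ^ 1 * (- 1) ^ card (residue_inversions a b \<inter> difference_layer b n)"
      using n j prime_gt_1_nat[OF p(1)] by (intro layer_sign_mult[OF b0 cop_u a assms(2)]) auto
    then show ?thesis using True by simp
  next
    case False
    define h where "h = gcd n m"
    have "h \<noteq> 1"
    proof
      assume "h = 1"
      then have "coprime n m" unfolding h_def by (rule gcd_eq_1_imp_coprime)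
      moreover have "n dvd p ^ e * m" using n unfolding b[symmetric] by simp
      ultimately have "n dvd p ^ e" by (simp only: coprime_dvd_mult_left_iff)
      then obtain j where "j \<le> e" "n = p ^ j" using divides_primepow_nat[OF p(1)] by auto
      moreover from this n have "j \<noteq> 0" by (cases "j = 0") simp_all
      ultimately have "n \<in> P" unfolding P_def by (intro image_eqI[of _ _ j]) simp_all
      with False show False ..
    qed
    moreover have "h \<noteq> 0" using n by (auto simp: h_def)
    ultimately have "h > 1" by simp
    have "[u = 1] (mod h)" using u(2) by (rule cong_dvd_modulus_nat) (simp add: h_def)
    then have "[int u ^ card (difference_layer b n) = 1 ^ card (difference_layer b n)] (mod int h)"
      using cong_int_iff[of u 1 h] by (intro cong_pow) simp
    then have "(- 1 :: int) ^ card (residue_inversions (u * a) b \<inter> difference_layer b n)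
        = (- 1) ^ 0 * (- 1) ^ card (residue_inversions a b \<inter> difference_layer b n)"
      using n \<open>h > 1\<close> by (intro layer_sign_mult[OF b0 cop_u a assms(2)]) (auto simp: h_def)
    then show ?thesis using False by simp
  qed
  have P_sub: "P \<subseteq> ?N"
    using prime_gt_1_nat[OF p(1)] one_less_power[of p]
    by (auto simp: P_def b intro!: dvd_mult2 le_imp_power_dvd simp del: One_nat_def)
  have fin: "finite ?N" using b0 by auto
  have "(- 1 :: int) ^ mult_inv (int (u * a)) b = - ((- 1) ^ mult_inv (int a) b)" if a: "coprime a b" for a
  proof -
    have "coprime (u * a) b" using cop_u a by simp
    then have "(- 1 :: int) ^ mult_inv (int (u * a)) b
        = (\<Prod>n\<in>?N. (- 1) ^ card (residue_inversions (u * a) b \<inter> difference_layer b n))"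
      by (rule sign_mult_inv_eq_prod[OF b0])
    also have "\<dots> = (\<Prod>n\<in>?N. (if n \<in> P then - 1 else 1) *
        (- 1) ^ card (residue_inversions a b \<inter> difference_layer b n))"
      using flip a by (intro prod.cong refl) blast
    also have "\<dots> = (\<Prod>n\<in>?N. if n \<in> P then - 1 else 1) * (- 1) ^ mult_inv (int a) b"
      unfolding prod.distrib sign_mult_inv_eq_prod[OF b0 a] ..
    also have "(\<Prod>n\<in>?N. if n \<in> P then - 1 else (1::int)) = (- 1) ^ card P"
      using P_sub fin by (simp add: prod.If_cases Int_absorb1 Collect_mem_eq)
    also have "\<dots> = - 1" using card_P p(2) by (simp add: e_def)
    finally show ?thesis by simp
  qed
  moreover have "[u = 1] (mod k)" using u(2) by (rule cong_dvd_modulus_nat) (simp add: m_def)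
  ultimately show ?thesis using that cop_u by blast
qed

section \<open>Vanishing at roots of unity\<close>

lemma mult_inv_mod: "mult_inv (int (a mod b)) b = mult_inv (int a) b"
proof -
  have "[m = int (a mod b) * x] (mod int b) \<longleftrightarrow> [m = int a * x] (mod int b)" for m x
    by (simp add: cong_def zmod_int mod_mult_left_eq)
  then show ?thesis unfolding mult_inv_def mult_perm_def by simp
qed

lemma poly_inversion_poly:
  fixes z :: complex
  shows "poly (map_poly of_int (inversion_poly b)) z
       = (\<Sum>a | 1 \<le> a \<and> a \<le> b \<and> coprime a b. z ^ mult_inv (int a) b)"
proof -
  have add: "map_poly of_int (p + q) = (map_poly of_int p + map_poly of_int q :: complex poly)" for p q
    by (rule poly_eqI) (simp add: coeff_map_poly)
  have "poly (map_poly of_int (sum f A)) z = (\<Sum>a\<in>A. poly (map_poly of_int (f a)) z)"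
    for f :: "nat \<Rightarrow> int poly" and A
    by (induction A rule: infinite_finite_induct) (simp_all add: add)
  then show ?thesis unfolding inversion_poly_def by (simp add: map_poly_monom poly_monom)
qed

lemma primitive_root_half_power:
  assumes "primitive_root_of_unity (2 * n) z"
  shows "z ^ n = - 1"
proof -
  have "n > 0" "(z ^ n)\<^sup>2 = 1" "z ^ n \<noteq> 1"
    using assms unfolding primitive_root_of_unity_def by (auto simp: power_mult[symmetric] mult.commute)
  then show ?thesis by (simp add: power2_eq_1_iff)
qed

text \<open>
  Two numbers of opposite parity that agree modulo the odd number \<open>n\<close> differ by an odd multiple of
  \<open>n\<close>.
\<close>

lemma power_eq_minus_power_if_cong:
  fixes z :: complex and i j n :: nat
  assumes "z ^ n = - 1" "[i = j] (mod n)" "odd n" "odd (i + j)"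
  shows "z ^ i = - (z ^ j)"
  using assms(2,4)
proof (induction i j rule: linorder_wlog)
  case (le i j)
  obtain t where "j = t * n + i"
    using cong_le_nat[OF le(1), of n] cong_sym[OF le(2)] by blast
  then have t: "j = i + n * t" by (simp add: mult.commute)
  then have "odd t" using le assms(3) by auto
  then show ?case unfolding t by (simp add: power_add power_mult assms(1))
next
  case (sym i j)
  then show ?case by (metis add.commute cong_sym minus_equation_iff)
qed

text \<open>
  Multiplication by \<open>u\<close> permutes the reduced residues, and it negates every term of the sum.
\<close>

lemma sum_mult_inv_power_eq_0:
  fixes z :: complex
  assumes "b > 1" "coprime u b"
    and neg: "\<And>a. coprime a b \<Longrightarrow> z ^ mult_inv (int (u * a)) b = - (z ^ mult_inv (int a) b)"
  shows "(\<Sum>a | 1 \<le> a \<and> a \<le> b \<and> coprime a b. z ^ mult_inv (int a) b) = 0"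
proof -
  define R where "R = {a. 1 \<le> a \<and> a \<le> b \<and> coprime a b}"
  have R: "R = {a \<in> {..<b}. coprime a b}"
  proof -
    have "a \<noteq> 0 \<and> a \<noteq> b" if "coprime a b" for a
      using that assms(1) by (metis coprime_0_left_iff coprime_self nat_dvd_1_iff_1 less_irrefl)
    then show ?thesis by (force simp: R_def le_less)
  qed
  have b0: "b > 0" using assms(1) by simp
  have "inj_on (\<lambda>a. u * a mod b) R"
    using bij_betw_imp_inj_on[OF bij_betw_mult_mod[OF b0 assms(2)]]
    by (rule inj_on_subset) (auto simp: R)
  moreover have "(\<lambda>a. u * a mod b) ` R \<subseteq> R"
    using assms by (auto simp: R coprime_mod_left_iff)
  ultimately have bij: "bij_betw (\<lambda>a. u * a mod b) R R"
    by (intro bij_betw_imageI endo_inj_surj) (auto simp: R)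
  have "(\<Sum>a\<in>R. z ^ mult_inv (int a) b) = (\<Sum>a\<in>R. z ^ mult_inv (int (u * a mod b)) b)"
    by (rule sum.reindex_bij_betw[OF bij, symmetric])
  also have "\<dots> = - (\<Sum>a\<in>R. z ^ mult_inv (int a) b)"
    unfolding sum_negf[symmetric]
    by (intro sum.cong refl) (simp only: mult_inv_mod, rule neg, simp add: R)
  finally show ?thesis unfolding R_def by simp
qed

text \<open>
  The congruence for \<open>4 * a * inv\<close> modulo \<open>k\<close> depends only on the residue of \<open>a\<close> modulo \<open>k\<close>, and
  \<open>4 * a\<close> can be cancelled as \<open>k\<close> is odd.
\<close>

lemma mult_inv_cong_if_multiplier_cong_1:
  assumes "odd b" "k dvd b" "coprime u b" "coprime a b" "[u = 1] (mod k)"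
  shows "[mult_inv (int (u * a)) b = mult_inv (int a) b] (mod k)"
proof -
  have b0: "b > 0" using assms(1) by (cases b) auto
  have cop: "coprime (4 * int a) (int k)"
  proof -
    have "odd k" using assms(1,2) by (meson dvd_trans)
    moreover have "coprime a k" using assms(2,4) by (rule coprime_divisors[OF dvd_refl])
    ultimately have "coprime (2 ^ 2 * int a) (int k)"
      by (simp only: coprime_mult_left_iff coprime_power_left_iff) simp
    then show ?thesis by simp
  qed
  have mod_k: "[4 * int x * int (mult_inv (int x) b) = - (int x - 1)\<^sup>2] (mod int k)" if "coprime x b" for x
    using cong_dvd_modulus[OF mult_inv_cong[OF b0 that]] assms(2) by simp
  have "[int u * int a = 1 * int a] (mod int k)"
    using assms(5) by (intro cong_scalar_right) (metis cong_int_iff of_nat_1)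
  then have ua: "[int (u * a) = int a] (mod int k)" by simp
  have "[4 * int a * int (mult_inv (int (u * a)) b)
      = 4 * int (u * a) * int (mult_inv (int (u * a)) b)] (mod int k)"
    by (intro cong_mult cong_refl cong_sym[OF ua])
  also have "[4 * int (u * a) * int (mult_inv (int (u * a)) b) = - (int (u * a) - 1)\<^sup>2] (mod int k)"
    using assms by (intro mod_k) simp
  also have "[- (int (u * a) - 1)\<^sup>2 = - (int a - 1)\<^sup>2] (mod int k)"
    unfolding cong_minus_minus_iff by (intro cong_pow cong_diff cong_refl ua)
  also have "[- (int a - 1)\<^sup>2 = 4 * int a * int (mult_inv (int a) b)] (mod int k)"
    by (rule cong_sym[OF mod_k[OF assms(4)]])
  finally show ?thesis using cop by (simp add: cong_mult_lcancel cong_int_iff)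
qed

theorem proposition2p4:
  fixes b c k :: nat
  assumes "c > 0" and "k > 0"
    and "b = c * k"
    and "odd b"
    and "\<not> is_square c"
    and "coprime c k"
  shows "(\<forall>\<zeta>. primitive_root_of_unity (2 * k) \<zeta> \<longrightarrow> poly (map_poly of_int (inversion_poly b)) \<zeta> = 0) \<and>
         (\<not> 3 dvd b \<longrightarrow>
           (\<forall>\<zeta>. primitive_root_of_unity (6 * k) \<zeta> \<longrightarrow> poly (map_poly of_int (inversion_poly b)) \<zeta> = 0))"
proof -
  obtain u where u: "coprime u b" "[u = 1] (mod k)"
    and flip: "\<And>a. coprime a b \<Longrightarrow>
      (- 1 :: int) ^ mult_inv (int (u * a)) b = - ((- 1) ^ mult_inv (int a) b)"
    using ex_sign_flipping_multiplier[OF assms(3-6)] by metis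
  have "c \<noteq> 1" using assms(5) by auto
  then have b1: "b > 1" using assms(1-3)
    by (metis One_nat_def Suc_lessI mult_eq_1_iff nat_0_less_mult_iff)
  have b0: "b > 0" using b1 by simp
  have odd_k: "odd k" using assms(3,4) by simp
  have parity: "odd (mult_inv (int (u * a)) b + mult_inv (int a) b)" if "coprime a b" for a
    using flip[OF that]
    by (cases "even (mult_inv (int (u * a)) b)"; cases "even (mult_inv (int a) b)") auto
  have cong_k: "[mult_inv (int (u * a)) b = mult_inv (int a) b] (mod k)" if "coprime a b" for a
    using assms(3,4) u that by (intro mult_inv_cong_if_multiplier_cong_1) auto
  have root: "poly (map_poly of_int (inversion_poly b)) z = 0"
    if "primitive_root_of_unity (2 * n) z" "odd n"
      and "\<And>a. coprime a b \<Longrightarrow> [mult_inv (int (u * a)) b = mult_inv (int a) b] (mod n)" for n z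
    unfolding poly_inversion_poly
    using power_eq_minus_power_if_cong[OF primitive_root_half_power[OF that(1)] that(3) that(2) parity]
    by (intro sum_mult_inv_power_eq_0[OF b1 u(1)])
  have "[mult_inv (int (u * a)) b = mult_inv (int a) b] (mod (3 * k))"
    if b3: "\<not> 3 dvd b" and a: "coprime a b" for a
  proof -
    have "3 dvd mult_inv (int (u * a)) b" "3 dvd mult_inv (int a) b"
      using three_dvd_mult_inv[OF b0 _ b3, of "u * a"] three_dvd_mult_inv[OF b0 _ b3, of a] u a
      by simp_all
    then have "[mult_inv (int (u * a)) b = mult_inv (int a) b] (mod 3)"
      by (simp add: cong_def)
    moreover have "coprime 3 k"
    proof (rule prime_imp_coprime)
      show "prime (3 :: nat)" by simp
    qed (use b3 assms(3) in auto)
    ultimately show ?thesis using cong_k[OF a] by (intro coprime_cong_mult_nat)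
  qed
  then show ?thesis
    using root[of k] root[of "3 * k"] cong_k odd_k by (auto simp: mult.assoc[symmetric])
qed

end
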